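(* Let $m,L,U$ be integers with $1\le L\le U\le m$, let $v_1,\dots,v_m\in\mathbb{R}$ and $\mu>0$, and let $\mathbf{M}^{\mathrm{BiC}}$, $\mathbf{b}$ be the matrix and vector associated with the BiC DAG. For any starting vector $\mathbf{z}^{0}\in\mathbb{R}^{|\mathcal{N}|}$, the value iteration $\mathbf{z}^{t+1}=\mathbf{M}^{\mathrm{BiC}}\mathbf{z}^{t}+\mathbf{b}$, $t=0,1,2,\dots$, solves the linear system $(\mathbf{I}-\mathbf{M}^{\mathrm{BiC}})\mathbf{z}=\mathbf{b}$ after $m+2$ iterations, i.e. $(\mathbf{I}-\mathbf{M}^{\mathrm{BiC}})\mathbf{z}^{m+2}=\mathbf{b}$. As a result, the value function $V^{\mathrm{BiC}}$ can be computed in $\mathcal{O}(m^2U)$ time (number of elementary real operations, with an absolute constant).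
   Context: BiC DAG: nodes (set $\mathcal{N}$) are $p^c_j$ with $0\le j\le m$, $0\le c\le \min(j,U)$, and a destination $d$. Arcs are: $p^c_j\to p^c_{j+1}$ for $0\le j\le m-1$; $p^c_j\to p^{c+1}_{j+1}$ for $0\le j\le m-1$ and $c<U$; $p^c_m\to d$ for $L\le c\le U$. $N(k)$ is the set of heads of arcs leaving node $k$. Arc utilities: $v^{\mathrm{BiC}}(p^c_{j+1}|p^c_j)=0$, $v^{\mathrm{BiC}}(p^{c+1}_{j+1}|p^c_j)=v_{j+1}$, $v^{\mathrm{BiC}}(d|k)=0$. $\mathbf{M}^{\mathrm{BiC}}$ is the $|\mathcal{N}|\times|\mathcal{N}|$ matrix with $M^{\mathrm{BiC}}_{ka}=\exp(\tfrac1\mu v^{\mathrm{BiC}}(a|k))$ if $k\ne d$ and $a\in N(k)$, and $0$ otherwise; $\mathbf{b}$ has $b_d=1$ and all other entries $0$; $\mathbf{I}$ is the identity matrix. Value function: $V^{\mathrm{BiC}}(d)=0$, $V^{\mathrm{BiC}}(k)=-\infty$ if $k\ne d$ and $N(k)=\emptyset$, otherwise $V^{\mathrm{BiC}}(k)=\mu\ln\sum_{a\in N(k)}\exp(\tfrac1\mu(v^{\mathrm{BiC}}(a|k)+V^{\mathrm{BiC}}(a)))$ (with $\exp(-\infty)=0$, $\ln 0=-\infty$). The vector with entries $z_k=\exp(V^{\mathrm{BiC}}(k)/\mu)$ satisfies $(\mathbf{I}-\mathbf{M}^{\mathrm{BiC}})\mathbf{z}=\mathbf{b}$. Cost model: each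 real arithmetic operation, exponential or logarithm costs one unit; only nonzero entries of $\mathbf{M}^{\mathrm{BiC}}$ are stored and used. *)

theory Defs
  imports "HOL-Library.Extended_Real"
begin

section \<open>The BiC DAG\<close>

text \<open>\<open>P j c\<close> stands for the node \<open>p\<close> with subscript \<open>j\<close> and superscript \<open>c\<close>.\<close>

datatype node = P nat nat | Dest

definition bic_nodes :: "nat \<Rightarrow> nat \<Rightarrow> node set" where
  "bic_nodes m U = {P j c | j c. j \<le> m \<and> c \<le> min j U} \<union> {Dest}"

definition bic_arcs :: "nat \<Rightarrow> nat \<Rightarrow> nat \<Rightarrow> (node \<times> node) set" where
  "bic_arcs m L U =
     {(P j c, P (j + 1) c) | j c. j < m \<and> c \<le> min j U} \<union>
     {(P j c, P (j + 1) (c + 1)) | j c. j < m \<and> c \<le> min j U \<and> c < U} \<union>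
     {(P m c, Dest) | c. L \<le> c \<and> c \<le> U}"

definition heads :: "nat \<Rightarrow> nat \<Rightarrow> nat \<Rightarrow> node \<Rightarrow> node set" where
  "heads m L U k = {a. (k, a) \<in> bic_arcs m L U}"

text \<open>\<open>bic_util v k a\<close> is the utility of the arc from \<open>k\<close> to \<open>a\<close>; it is only meaningful on arcs.\<close>

fun bic_util :: "(nat \<Rightarrow> real) \<Rightarrow> node \<Rightarrow> node \<Rightarrow> real" where
  "bic_util v (P j c) (P j' c') = (if c' = c + 1 then v (j + 1) else 0)"
| "bic_util v k a = 0"


section \<open>Linear system and value iteration\<close>

text \<open>Vectors and matrices are indexed by the finite node set: only their entries at nodes in
  \<^const>\<open>bic_nodes\<close> are significant, and vector equations are read entrywise on that set.\<close>

definition mat_vec :: "'a set \<Rightarrow> ('a \<Rightarrow> 'a \<Rightarrow> real) \<Rightarrow> ('a \<Rightarrow> real) \<Rightarrow> 'a \<Rightarrow> real" where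
  "mat_vec S A z k = (\<Sum>a\<in>S. A k a * z a)"

definition id_mat :: "'a \<Rightarrow> 'a \<Rightarrow> real" where
  "id_mat k a = (if k = a then 1 else 0)"

definition bic_M ::
  "nat \<Rightarrow> nat \<Rightarrow> nat \<Rightarrow> (nat \<Rightarrow> real) \<Rightarrow> real \<Rightarrow> node \<Rightarrow> node \<Rightarrow> real" where
  "bic_M m L U v \<mu> k a =
     (if k \<noteq> Dest \<and> a \<in> heads m L U k then exp (1 / \<mu> * bic_util v k a) else 0)"

definition bic_b :: "node \<Rightarrow> real" where
  "bic_b k = (if k = Dest then 1 else 0)"

primrec value_iter ::
  "nat \<Rightarrow> nat \<Rightarrow> nat \<Rightarrow> (nat \<Rightarrow> real) \<Rightarrow> real \<Rightarrow> (node \<Rightarrow> real) \<Rightarrow> nat \<Rightarrow> node \<Rightarrow> real" where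
  "value_iter m L U v \<mu> z0 0 = z0"
| "value_iter m L U v \<mu> z0 (Suc t) =
     (\<lambda>k. mat_vec (bic_nodes m U) (bic_M m L U v \<mu>) (value_iter m L U v \<mu> z0 t) k + bic_b k)"

definition solves_bic_system ::
  "nat \<Rightarrow> nat \<Rightarrow> nat \<Rightarrow> (nat \<Rightarrow> real) \<Rightarrow> real \<Rightarrow> (node \<Rightarrow> real) \<Rightarrow> bool" where
  "solves_bic_system m L U v \<mu> z \<longleftrightarrow>
     (\<forall>k\<in>bic_nodes m U.
        mat_vec (bic_nodes m U) (\<lambda>k a. id_mat k a - bic_M m L U v \<mu> k a) z k = bic_b k)"


section \<open>Value function\<close>

definition exp_ereal :: "ereal \<Rightarrow> ereal" where
  "exp_ereal x =
     (if x = \<infinity> then \<infinity> else if x = -\<infinity> then 0 else ereal (exp (real_of_ereal x)))"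

text \<open>The value at negative arguments is a totalization and carries no meaning.\<close>

definition ln_ereal :: "ereal \<Rightarrow> ereal" where
  "ln_ereal x =
     (if x = \<infinity> then \<infinity> else if x \<le> 0 then -\<infinity> else ereal (ln (real_of_ereal x)))"

function bic_value ::
  "nat \<Rightarrow> nat \<Rightarrow> nat \<Rightarrow> (nat \<Rightarrow> real) \<Rightarrow> real \<Rightarrow> node \<Rightarrow> ereal" where
  "bic_value m L U v \<mu> k =
     (if k = Dest then 0
      else if heads m L U k = {} then -\<infinity>
      else ereal \<mu> * ln_ereal (\<Sum>a\<in>heads m L U k.
             exp_ereal (ereal (1 / \<mu>) * (ereal (bic_util v k a) + bic_value m L U v \<mu> a))))"
  by auto
termination
  by (relation "measure (\<lambda>(m, L, U, v, \<mu>, k). case k of Dest \<Rightarrow> 0 | P j c \<Rightarrow> Suc m - j)")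
    (auto simp: heads_def bic_arcs_def)

declare bic_value.simps [simp del]


section \<open>Cost model\<close>

text \<open>A small language of loop programs over natural-number index variables and arrays of
  (extended) real cells.  Every program is a finite piece of syntax, so one program has to serve
  all problem sizes.  The extended reals are needed only because \<open>ln 0 = -\<infinity>\<close> is a possible value.
  Control flow and addressing depend on index variables alone and never on cell contents; the
  counter \<open>ops\<close> is increased by one for each arithmetic operation, exponential or logarithm
  performed on cell contents, and by nothing else.\<close>

datatype iexp =
    INum nat
  | IVar string
  | IAdd iexp iexp
  | ISub iexp iexp
  | IMul iexp iexp

datatype itest =
    ILe iexp iexp
  | INot itest
  | IAnd itest itest

datatype rexp =
    RNum int
  | RCell string "iexp list"
  | RAdd rexp rexp
  | RSub rexp rexp
  | RMul rexp rexp
  | RDiv rexp rexp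
  | RExp rexp
  | RLn rexp

datatype com =
    Skip
  | ISet string iexp
  | RSet string "iexp list" rexp
  | Seq com com
  | If itest com com
  | For string iexp com

record state =
  idx :: "string \<Rightarrow> nat"
  mem :: "string \<Rightarrow> nat list \<Rightarrow> ereal"
  ops :: nat

primrec ieval :: "iexp \<Rightarrow> (string \<Rightarrow> nat) \<Rightarrow> nat" where
  "ieval (INum n) i = n"
| "ieval (IVar x) i = i x"
| "ieval (IAdd e f) i = ieval e i + ieval f i"
| "ieval (ISub e f) i = ieval e i - ieval f i"
| "ieval (IMul e f) i = ieval e i * ieval f i"

primrec teval :: "itest \<Rightarrow> (string \<Rightarrow> nat) \<Rightarrow> bool" where
  "teval (ILe e f) i \<longleftrightarrow> ieval e i \<le> ieval f i"
| "teval (INot t) i \<longleftrightarrow> \<not> teval t i"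
| "teval (IAnd t u) i \<longleftrightarrow> teval t i \<and> teval u i"

primrec reval :: "rexp \<Rightarrow> state \<Rightarrow> ereal" where
  "reval (RNum n) s = ereal (of_int n)"
| "reval (RCell x es) s = mem s x (map (\<lambda>e. ieval e (idx s)) es)"
| "reval (RAdd e f) s = reval e s + reval f s"
| "reval (RSub e f) s = reval e s - reval f s"
| "reval (RMul e f) s = reval e s * reval f s"
| "reval (RDiv e f) s = reval e s / reval f s"
| "reval (RExp e) s = exp_ereal (reval e s)"
| "reval (RLn e) s = ln_ereal (reval e s)"

primrec rcost :: "rexp \<Rightarrow> nat" where
  "rcost (RNum n) = 0"
| "rcost (RCell x es) = 0"
| "rcost (RAdd e f) = rcost e + rcost f + 1"
| "rcost (RSub e f) = rcost e + rcost f + 1"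
| "rcost (RMul e f) = rcost e + rcost f + 1"
| "rcost (RDiv e f) = rcost e + rcost f + 1"
| "rcost (RExp e) = rcost e + 1"
| "rcost (RLn e) = rcost e + 1"

text \<open>\<open>For x e c\<close> runs \<open>c\<close> with \<open>x = 0, \<dots>, n - 1\<close>, where \<open>n\<close> is the value of \<open>e\<close> on entry.\<close>

primrec exec :: "com \<Rightarrow> state \<Rightarrow> state" where
  "exec Skip s = s"
| "exec (ISet x e) s = s\<lparr>idx := (idx s)(x := ieval e (idx s))\<rparr>"
| "exec (RSet x es r) s =
     s\<lparr>mem := (mem s)(x := (mem s x)(map (\<lambda>e. ieval e (idx s)) es := reval r s)),
       ops := ops s + rcost r\<rparr>"
| "exec (Seq c d) s = exec d (exec c s)"
| "exec (If t c d) s = (if teval t (idx s) then exec c s else exec d s)"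
| "exec (For x e c) s =
     fold (\<lambda>i s'. exec c (s'\<lparr>idx := (idx s')(x := i)\<rparr>)) [0..<ieval e (idx s)] s"

text \<open>Input convention: sizes in index variables \<open>m\<close>, \<open>L\<close>, \<open>U\<close>, the scale in the cell \<open>mu\<close>, and
  \<open>v 1, \<dots>, v m\<close> in the array \<open>v\<close>.  Output convention: the value at \<open>P j c\<close> in cell
  \<open>(j, c)\<close> of the array \<open>V\<close>, the value at \<^const>\<open>Dest\<close> in the cell \<open>Vd\<close>.\<close>

definition bic_input :: "nat \<Rightarrow> nat \<Rightarrow> nat \<Rightarrow> (nat \<Rightarrow> real) \<Rightarrow> real \<Rightarrow> state" where
  "bic_input m L U v \<mu> =
     \<lparr>idx = (\<lambda>_. 0)(''m'' := m, ''L'' := L, ''U'' := U),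
      mem = (\<lambda>_ _. 0)(''mu'' := (\<lambda>_. 0)([] := ereal \<mu>),
                       ''v'' := (\<lambda>l. case l of [j] \<Rightarrow> if 1 \<le> j \<and> j \<le> m then ereal (v j) else 0
                                              | _ \<Rightarrow> 0)),
      ops = 0\<rparr>"

fun bic_output :: "state \<Rightarrow> node \<Rightarrow> ereal" where
  "bic_output s (P j c) = mem s ''V'' [j, c]"
| "bic_output s Dest = mem s ''Vd'' []"

definition computes_bic_value ::
  "com \<Rightarrow> nat \<Rightarrow> nat \<Rightarrow> nat \<Rightarrow> (nat \<Rightarrow> real) \<Rightarrow> real \<Rightarrow> bool" where
  "computes_bic_value prog m L U v \<mu> \<longleftrightarrow>
     (\<forall>k\<in>bic_nodes m U.
        bic_output (exec prog (bic_input m L U v \<mu>)) k = bic_value m L U v \<mu> k)"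

definition bic_ops ::
  "com \<Rightarrow> nat \<Rightarrow> nat \<Rightarrow> nat \<Rightarrow> (nat \<Rightarrow> real) \<Rightarrow> real \<Rightarrow> nat" where
  "bic_ops prog m L U v \<mu> = ops (exec prog (bic_input m L U v \<mu>))"

end

theory Submission
  imports Defs
begin

text \<open>Every arc lowers the rank \<open>m + 1 - j\<close> of \<open>p\<^sub>j\<close> (with rank \<open>0\<close> at \<open>d\<close>), so the entry of the value
  iterates at a node of rank \<open>r\<close> is constant from iteration \<open>r + 1\<close> on; the largest rank is \<open>m + 1\<close>.
  For the running time, the layers \<open>j = m, \<dots>, 0\<close> are evaluated backwards: each of the at most
  \<open>(m + 1)(U + 1) \<le> 4 m U\<close> nodes has at most two successors and takes at most \<open>11\<close> operations.\<close>

section \<open>Stabilization of the value iteration\<close>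

fun bic_rank :: "nat \<Rightarrow> node \<Rightarrow> nat" where
  "bic_rank m (P j c) = Suc m - j"
| "bic_rank m Dest = 0"

lemma bic_rank_heads_less: "a \<in> heads m L U k \<Longrightarrow> bic_rank m a < bic_rank m k"
  by (auto simp: heads_def bic_arcs_def)

lemma bic_rank_le: "bic_rank m k \<le> Suc m"
  by (cases k) auto

lemma finite_bic_nodes: "finite (bic_nodes m U)"
proof -
  have "bic_nodes m U \<subseteq> (\<lambda>(j, c). P j c) ` ({..m} \<times> {..U}) \<union> {Dest}"
    by (auto simp: bic_nodes_def)
  then show ?thesis
    by (rule finite_subset) auto
qed

lemma mat_vec_id_diff:
  assumes "finite S" and "k \<in> S"
  shows "mat_vec S (\<lambda>k a. id_mat k a - A k a) z k = z k - mat_vec S A z k"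
proof -
  have "(\<Sum>a\<in>S. id_mat k a * z a) = (\<Sum>a\<in>S. if k = a then z a else 0)"
    by (intro sum.cong) (auto simp: id_mat_def)
  then show ?thesis
    using assms by (simp add: mat_vec_def left_diff_distrib sum_subtractf)
qed

text \<open>Row \<open>k\<close> of the matrix vanishes off the heads of \<open>k\<close>, which
  have smaller rank, so induction on \<open>t\<close> applies. The inequality is strict because the
  start vector is arbitrary: even an entry of rank 0 may still change in the first step.\<close>

lemma value_iter_stable:
  "bic_rank m k < t \<Longrightarrow> value_iter m L U v \<mu> z0 (Suc t) k = value_iter m L U v \<mu> z0 t k"
proof (induction t arbitrary: k)
  case 0
  then show ?case by simp
next
  case (Suc t)
  have "bic_M m L U v \<mu> k a * value_iter m L U v \<mu> z0 (Suc t) a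
      = bic_M m L U v \<mu> k a * value_iter m L U v \<mu> z0 t a" for a
  proof (cases "a \<in> heads m L U k")
    case True
    then have "bic_rank m a < t"
      using bic_rank_heads_less Suc.prems by fastforce
    then show ?thesis
      using Suc.IH by presburger
  qed (simp add: bic_M_def)
  then have "mat_vec (bic_nodes m U) (bic_M m L U v \<mu>) (value_iter m L U v \<mu> z0 (Suc t)) k
      = mat_vec (bic_nodes m U) (bic_M m L U v \<mu>) (value_iter m L U v \<mu> z0 t) k"
    unfolding mat_vec_def by (intro sum.cong refl)
  then show ?case
    by (simp only: value_iter.simps)
qed

text \<open>As (I - M) z = z - M z, solving the system means being a fixed point of the iteration,
  so it suffices that one further step changes no entry.\<close>

lemma value_iter_solves: "solves_bic_system m L U v \<mu> (value_iter m L U v \<mu> z0 (m + 2))"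
  unfolding solves_bic_system_def
proof
  fix k
  assume k: "k \<in> bic_nodes m U"
  have "bic_rank m k < m + 2"
    using bic_rank_le[of m k] by simp
  from value_iter_stable[OF this, of L U v \<mu> z0] k
  show "mat_vec (bic_nodes m U) (\<lambda>k a. id_mat k a - bic_M m L U v \<mu> k a)
          (value_iter m L U v \<mu> z0 (m + 2)) k = bic_b k"
    unfolding mat_vec_id_diff[OF finite_bic_nodes k] by (simp only: value_iter.simps)
qed


section \<open>The value function layer by layer\<close>

lemma bic_value_Dest: "bic_value m L U v \<mu> Dest = 0"
  by (simp add: bic_value.simps)

lemma bic_value_last:
  assumes "c \<le> U"
  shows "bic_value m L U v \<mu> (P m c) = (if L \<le> c then 0 else -\<infinity>)"
proof -
  have "heads m L U (P m c) = (if L \<le> c then {Dest} else {})"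
    using assms by (auto simp: heads_def bic_arcs_def)
  then show ?thesis
    by (simp add: bic_value.simps[of m L U v \<mu> "P m c"] bic_value_Dest exp_ereal_def ln_ereal_def
        zero_ereal_def)
qed

text \<open>The summand \<open>0\<close> is the utility of the arc that keeps the superscript. It
  stays visible so that the right-hand side has the shape of the expression the program
  evaluates.\<close>

lemma bic_value_inner:
  assumes "j < m" and "c \<le> min j U" and "c < U"
  shows "bic_value m L U v \<mu> (P j c) =
    ereal \<mu> * ln_ereal
      (exp_ereal (ereal (1 / \<mu>) * (0 + bic_value m L U v \<mu> (P (Suc j) c))) +
       exp_ereal (ereal (1 / \<mu>) * (ereal (v (Suc j)) + bic_value m L U v \<mu> (P (Suc j) (Suc c)))))"
proof -
  have "heads m L U (P j c) = {P (Suc j) c, P (Suc j) (Suc c)}"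
    using assms by (auto simp: heads_def bic_arcs_def)
  then show ?thesis
    by (simp add: bic_value.simps[of m L U v \<mu> "P j c"] zero_ereal_def[symmetric])
qed

lemma bic_value_top:
  assumes "j < m" and "U \<le> j"
  shows "bic_value m L U v \<mu> (P j U) =
    ereal \<mu> * ln_ereal (exp_ereal (ereal (1 / \<mu>) * (0 + bic_value m L U v \<mu> (P (Suc j) U))))"
proof -
  have "heads m L U (P j U) = {P (Suc j) U}"
    using assms by (auto simp: heads_def bic_arcs_def)
  then show ?thesis
    by (simp add: bic_value.simps[of m L U v \<mu> "P j U"] zero_ereal_def[symmetric])
qed


section \<open>Backward induction as a program\<close>

text \<open>\<open>I n\<close> describes the state after \<open>n\<close> completed rounds, before
  the loop variable is set for the next one.\<close>

lemma exec_For_invariant: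
  assumes "I 0 s"
    and "\<And>i s'. i < ieval e (idx s) \<Longrightarrow> I i s' \<Longrightarrow> I (Suc i) (exec c (s'\<lparr>idx := (idx s')(x := i)\<rparr>))"
  shows "I (ieval e (idx s)) (exec (For x e c) s)"
proof -
  have "n \<le> ieval e (idx s) \<Longrightarrow>
      I n (fold (\<lambda>i s'. exec c (s'\<lparr>idx := (idx s')(x := i)\<rparr>)) [0..<n] s)" for n
    by (induction n) (use assms in auto)
  then show ?thesis
    by simp
qed

definition mu_cell :: rexp where
  "mu_cell = RCell ''mu'' []"

text \<open>Loops only count upwards, so the backward order comes from this reflection. The loop
  keeps \<open>i\<close> at most \<open>m\<close>, so the subtraction never truncates.\<close>

definition layer :: iexp where
  "layer = ISub (IVar ''m'') (IVar ''i'')"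

definition next_layer :: iexp where
  "next_layer = IAdd layer (INum 1)"

definition arc_term :: "rexp \<Rightarrow> iexp \<Rightarrow> rexp" where
  "arc_term u c = RExp (RMul (RDiv (RNum 1) mu_cell) (RAdd u (RCell ''V'' [next_layer, c])))"

definition set_value :: "rexp \<Rightarrow> com" where
  "set_value r = RSet ''V'' [layer, IVar ''c''] r"

text \<open>\<open>ln 0\<close> serves as the constant \<open>-\<infinity>\<close>, which is not a literal of the language.\<close>

definition node_step :: com where
  "node_step =
     If (ILe (IVar ''i'') (INum 0))
       (If (ILe (IVar ''L'') (IVar ''c'')) (set_value (RNum 0)) (set_value (RLn (RNum 0))))
       (If (ILe (IVar ''U'') (IVar ''c''))
         (set_value (RMul mu_cell (RLn (arc_term (RNum 0) (IVar ''c'')))))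
         (set_value (RMul mu_cell (RLn
            (RAdd (arc_term (RNum 0) (IVar ''c''))
                  (arc_term (RCell ''v'' [next_layer]) (IAdd (IVar ''c'') (INum 1))))))))"

definition layer_step :: com where
  "layer_step = For ''c'' (IAdd (IVar ''U'') (INum 1)) node_step"

definition backward :: com where
  "backward =
     Seq (RSet ''Vd'' [] (RNum 0))
         (For ''i'' (IAdd (IVar ''m'') (INum 1)) layer_step)"

text \<open>Layers are counted from the last one.  The restriction to \<open>c \<le> min j U\<close> is needed because the
  program also writes cells \<open>(j, c)\<close> with \<open>c > j\<close>; these correspond to no node and are never read
  for one.\<close>

definition computed_upto ::
  "nat \<Rightarrow> nat \<Rightarrow> nat \<Rightarrow> (nat \<Rightarrow> real) \<Rightarrow> real \<Rightarrow> nat \<Rightarrow> nat \<Rightarrow> state \<Rightarrow> bool" where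
  "computed_upto m L U v \<mu> i n s \<longleftrightarrow>
     idx s ''m'' = m \<and> idx s ''L'' = L \<and> idx s ''U'' = U \<and>
     mem s ''mu'' [] = ereal \<mu> \<and> (\<forall>j. 1 \<le> j \<and> j \<le> m \<longrightarrow> mem s ''v'' [j] = ereal (v j)) \<and>
     mem s ''Vd'' [] = 0 \<and>
     (\<forall>j c. j \<le> m \<and> c \<le> min j U \<and> (m < j + i \<or> j + i = m \<and> c < n) \<longrightarrow>
        mem s ''V'' [j, c] = bic_value m L U v \<mu> (P j c)) \<and>
     ops s \<le> 11 * (i * (U + 1) + n)"

text \<open>Every branch is a single assignment to the same cell, so it suffices to exhibit the
  assigned expression \<open>r\<close>. Its cost counts for every \<open>n\<close>, its value only
  when \<open>n \<le> j\<close>.\<close>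

lemma node_step_correct:
  assumes inv: "computed_upto m L U v \<mu> i n s" and i: "idx s ''i'' = i" and c: "idx s ''c'' = n"
    and le: "i \<le> m" "n \<le> U" and \<mu>: "\<mu> > 0"
  shows "computed_upto m L U v \<mu> i (Suc n) (exec node_step s)"
    and "idx (exec node_step s) = idx s"
proof -
  define j where "j = m - i"
  have V: "mem s ''V'' [j', c'] = bic_value m L U v \<mu> (P j' c')"
    if "j' \<le> m" "c' \<le> min j' U" "m < j' + i" for j' c'
    using inv that by (simp add: computed_upto_def)
  have "\<exists>r. rcost r \<le> 11 \<and> exec node_step s = exec (set_value r) s \<and>
      (n \<le> j \<longrightarrow> reval r s = bic_value m L U v \<mu> (P j n))"
  proof (cases "i = 0")
    case True
    define r where "r = (if L \<le> n then RNum 0 else RLn (RNum 0))"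
    have "exec node_step s = exec (set_value r) s"
      using inv i c True by (simp add: node_step_def computed_upto_def r_def)
    moreover have "reval r s = bic_value m L U v \<mu> (P j n)"
      using True le by (simp add: r_def j_def bic_value_last ln_ereal_def zero_ereal_def)
    moreover have "rcost r \<le> 11"
      by (simp add: r_def)
    ultimately show ?thesis
      by blast
  next
    case False
    then have j: "j < m" "Suc j \<le> m" "m < Suc j + i"
      using le by (auto simp: j_def)
    \<comment> \<open>This is where positivity enters: for \<mu> = 0 the extended quotient is
      infinite while the real one is 0.\<close>
    have mu: "ereal 1 / ereal \<mu> = ereal (1 / \<mu>)"
      using \<mu> by simp
    have cells: "mem s ''mu'' [] = ereal \<mu>" "mem s ''v'' [Suc j] = ereal (v (Suc j))"
      "ieval layer (idx s) = j" "ieval next_layer (idx s) = Suc j"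
      using inv i j by (auto simp: computed_upto_def layer_def next_layer_def j_def)
    show ?thesis
    proof (cases "n < U")
      case True
      define r where "r = RMul mu_cell (RLn
            (RAdd (arc_term (RNum 0) (IVar ''c''))
                  (arc_term (RCell ''v'' [next_layer]) (IAdd (IVar ''c'') (INum 1)))))"
      have "exec node_step s = exec (set_value r) s"
        using inv i c True False by (simp add: node_step_def computed_upto_def r_def)
      \<comment> \<open>For \<open>n \<le> j\<close> and \<open>n < U\<close> both successors are
        genuine nodes of the finished layer \<open>Suc j\<close>, so their cells are
        correct.\<close>
      moreover have "reval r s = bic_value m L U v \<mu> (P j n)" if "n \<le> j"
        using True c cells mu j that V[of "Suc j" n] V[of "Suc j" "Suc n"]
        by (simp add: r_def mu_cell_def arc_term_def bic_value_inner zero_ereal_def[symmetric])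
      \<comment> \<open>Four operations for each of the two arc terms, then the sum, the logarithm
        and the product with \<mu>.\<close>
      moreover have "rcost r \<le> 11"
        by (simp add: r_def mu_cell_def arc_term_def)
      ultimately show ?thesis
        by blast
    next
      case nU: False
      then have n: "n = U"
        using le by simp
      define r where "r = RMul mu_cell (RLn (arc_term (RNum 0) (IVar ''c'')))"
      have "exec node_step s = exec (set_value r) s"
        using inv i c nU False by (simp add: node_step_def computed_upto_def r_def)
      moreover have "reval r s = bic_value m L U v \<mu> (P j n)" if "n \<le> j"
        using n c cells mu j that V[of "Suc j" n]
        by (simp add: r_def mu_cell_def arc_term_def bic_value_top zero_ereal_def[symmetric])
      moreover have "rcost r \<le> 11"
        by (simp add: r_def mu_cell_def arc_term_def)
      ultimately show ?thesis
        by blast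
    qed
  qed
  then obtain r where r: "rcost r \<le> 11" "n \<le> j \<Longrightarrow> reval r s = bic_value m L U v \<mu> (P j n)"
    and step: "exec node_step s = exec (set_value r) s"
    by blast
  have exec: "exec node_step s =
      s\<lparr>mem := (mem s)(''V'' := (mem s ''V'')([j, n] := reval r s)), ops := ops s + rcost r\<rparr>"
    using inv i c by (simp add: step set_value_def layer_def computed_upto_def j_def)
  show "computed_upto m L U v \<mu> i (Suc n) (exec node_step s)"
    unfolding exec
    using inv le r by (auto simp: computed_upto_def j_def less_Suc_eq)
  show "idx (exec node_step s) = idx s"
    by (simp add: exec)
qed

lemma layer_step_correct:
  assumes "computed_upto m L U v \<mu> i 0 s" and "idx s ''i'' = i" and "i \<le> m" and "\<mu> > 0"
  shows "computed_upto m L U v \<mu> (Suc i) 0 (exec layer_step s)"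
proof -
  \<comment> \<open>\<open>computed_upto\<close> does not constrain the index variable
    \<open>i\<close>, so the inner loop has to carry its value along.\<close>
  define I where "I n s \<longleftrightarrow> computed_upto m L U v \<mu> i n s \<and> idx s ''i'' = i" for n s
  have U: "idx s ''U'' = U"
    using assms by (simp add: computed_upto_def)
  have "I (ieval (IAdd (IVar ''U'') (INum 1)) (idx s)) (exec layer_step s)"
    unfolding layer_step_def
  proof (rule exec_For_invariant)
    show "I 0 s"
      using assms by (simp add: I_def)
  next
    fix n s'
    assume n: "n < ieval (IAdd (IVar ''U'') (INum 1)) (idx s)" and I: "I n s'"
    let ?s = "s'\<lparr>idx := (idx s')(''c'' := n)\<rparr>"
    have "computed_upto m L U v \<mu> i n ?s" "idx ?s ''i'' = i" "idx ?s ''c'' = n"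
      using I by (auto simp: I_def computed_upto_def)
    from node_step_correct[OF this] show "I (Suc n) (exec node_step ?s)"
      using n U assms I by (auto simp: I_def)
  qed
  then have layer: "computed_upto m L U v \<mu> i (U + 1) (exec layer_step s)"
    using U by (simp add: I_def)
  \<comment> \<open>A full current layer is a finished one, since \<open>c \<le> U\<close> makes
    \<open>c < U + 1\<close> automatic. The cost bounds agree as well.\<close>
  have iff: "j \<le> m \<and> c \<le> min j U \<and> (m < j + Suc i \<or> j + Suc i = m \<and> c < 0) \<longleftrightarrow>
      j \<le> m \<and> c \<le> min j U \<and> (m < j + i \<or> j + i = m \<and> c < U + 1)" for j c
    by auto
  then show ?thesis
    using layer unfolding computed_upto_def iff
    by (elim conjE, intro conjI) (assumption | simp)+
qed

lemma backward_correct: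
  assumes "\<mu> > 0"
  shows "computed_upto m L U v \<mu> (Suc m) 0 (exec backward (bic_input m L U v \<mu>))"
proof -
  define s where "s = exec (RSet ''Vd'' [] (RNum 0)) (bic_input m L U v \<mu>)"
  have m: "idx s ''m'' = m"
    by (simp add: s_def bic_input_def)
  have "computed_upto m L U v \<mu> (ieval (IAdd (IVar ''m'') (INum 1)) (idx s)) 0
      (exec (For ''i'' (IAdd (IVar ''m'') (INum 1)) layer_step) s)"
  proof (rule exec_For_invariant[where I = "\<lambda>i. computed_upto m L U v \<mu> i 0"])
    \<comment> \<open>No layer is finished yet, so the claim about \<open>V\<close> is vacuous;
      storing a literal costs nothing.\<close>
    show "computed_upto m L U v \<mu> 0 0 s"
      by (auto simp: computed_upto_def s_def bic_input_def)
  next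
    fix i s'
    assume "i < ieval (IAdd (IVar ''m'') (INum 1)) (idx s)" and "computed_upto m L U v \<mu> i 0 s'"
    then show "computed_upto m L U v \<mu> (Suc i) 0 (exec layer_step (s'\<lparr>idx := (idx s')(''i'' := i)\<rparr>))"
      using assms m by (intro layer_step_correct) (auto simp: computed_upto_def)
  qed
  then show ?thesis
    using m by (simp add: backward_def s_def)
qed

lemma backward_computes:
  assumes "\<mu> > 0"
  shows "computes_bic_value backward m L U v \<mu>"
  using backward_correct[OF assms, of m L U v]
  by (auto simp: computes_bic_value_def bic_nodes_def computed_upto_def bic_value_Dest)

lemma backward_ops:
  assumes "1 \<le> U" and "1 \<le> m" and "\<mu> > 0"
  shows "bic_ops backward m L U v \<mu> \<le> 44 * (m\<^sup>2 * U)"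
proof -
  have "bic_ops backward m L U v \<mu> \<le> 11 * ((m + 1) * (U + 1))"
    using backward_correct[OF assms(3), of m L U v] by (simp add: bic_ops_def computed_upto_def)
  also have "\<dots> \<le> 11 * ((2 * m) * (2 * U))"
    using assms by (intro mult_le_mono) auto
  \<comment> \<open>The count is already linear in \<open>m * U\<close>; this step only weakens
    \<open>m\<close> to its square.\<close>
  also have "\<dots> \<le> 44 * (m\<^sup>2 * U)"
    using assms by (simp add: power2_eq_square)
  finally show ?thesis .
qed

theorem proposition7:
  shows "(\<forall>(m::nat) (L::nat) (U::nat) (v :: nat \<Rightarrow> real) (\<mu>::real) (z0 :: node \<Rightarrow> real).
            1 \<le> L \<and> L \<le> U \<and> U \<le> m \<and> \<mu> > 0 \<longrightarrow>
            solves_bic_system m L U v \<mu> (value_iter m L U v \<mu> z0 (m + 2)))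
       \<and> (\<exists>(prog::com) (C::nat).
            \<forall>(m::nat) (L::nat) (U::nat) (v :: nat \<Rightarrow> real) (\<mu>::real).
              1 \<le> L \<and> L \<le> U \<and> U \<le> m \<and> \<mu> > 0 \<longrightarrow>
              computes_bic_value prog m L U v \<mu> \<and> bic_ops prog m L U v \<mu> \<le> C * (m\<^sup>2 * U))"
proof (intro conjI exI[of _ backward] exI[of _ 44] allI impI)
  fix m L U :: nat and v :: "nat \<Rightarrow> real" and \<mu> :: real and z0 :: "node \<Rightarrow> real"
  show "solves_bic_system m L U v \<mu> (value_iter m L U v \<mu> z0 (m + 2))"
    by (rule value_iter_solves)
next
  fix m L U :: nat and v :: "nat \<Rightarrow> real" and \<mu> :: real
  assume "1 \<le> L \<and> L \<le> U \<and> U \<le> m \<and> \<mu> > 0"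
  then show "computes_bic_value backward m L U v \<mu>"
    and "bic_ops backward m L U v \<mu> \<le> 44 * (m\<^sup>2 * U)"
    by (auto intro: backward_computes intro!: backward_ops)
qed

end
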